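(* Let $R$ be a commutative ring and $M$ a nonzero $R$-module that is hollow representable (resp. directly hollow representable). If every maximal hollow nonzero submodule of $M$ is second, then $M$ is second representable (resp. directly second representable).
   Context: Let $R$ be a commutative ring and $M$ a nonzero $R$-module. A submodule $K\le M$ is second if $K\neq 0$ and for every ideal $I\le R$ we have $IK=K$ or $IK=0$. A submodule $N\le M$ is small in $M$ if $N+L\neq M$ for every proper submodule $L\lneq M$. A module is hollow if each of its proper submodules is small in it. A maximal hollow submodule of $M$ is a hollow submodule of $M$ that is maximal, with respect to inclusion, among the hollow submodules of $M$. $M$ is hollow representable (resp. directly hollow representable) if $M$ is a finite sum (resp. finite internal direct sum) of hollow submodules. $M$ is second representable (resp. directly second representable) if $M$ is a finite sum (resp. finite internal direct sum) of second submodules. *)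

theory Defs
  imports "HOL-Algebra.Algebra"
begin

text \<open>Submodules are subsets of the ambient carrier; a submodule \<open>H\<close> of \<open>M\<close> is regarded as a
  module in its own right via \<open>M\<lparr>carrier := H\<rparr>\<close>.\<close>

definition small_submodule ::
    "('a, 'r) ring_scheme \<Rightarrow> ('a, 'b, 'm) module_scheme \<Rightarrow> 'b set \<Rightarrow> bool" where
  "small_submodule R M N \<longleftrightarrow>
     submodule N R M \<and>
     (\<forall>L. submodule L R M \<and> L \<noteq> carrier M \<longrightarrow> N <+>\<^bsub>M\<^esub> L \<noteq> carrier M)"

text \<open>The zero module is (vacuously) hollow.\<close>

definition hollow ::
    "('a, 'r) ring_scheme \<Rightarrow> ('a, 'b, 'm) module_scheme \<Rightarrow> bool" where
  "hollow R M \<longleftrightarrow> (\<forall>N. submodule N R M \<and> N \<noteq> carrier M \<longrightarrow> small_submodule R M N)"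

definition hollow_submodule ::
    "('a, 'r) ring_scheme \<Rightarrow> ('a, 'b, 'm) module_scheme \<Rightarrow> 'b set \<Rightarrow> bool" where
  "hollow_submodule R M H \<longleftrightarrow> submodule H R M \<and> hollow R (M\<lparr>carrier := H\<rparr>)"

definition maximal_hollow_submodule ::
    "('a, 'r) ring_scheme \<Rightarrow> ('a, 'b, 'm) module_scheme \<Rightarrow> 'b set \<Rightarrow> bool" where
  "maximal_hollow_submodule R M H \<longleftrightarrow>
     hollow_submodule R M H \<and> (\<forall>H'. hollow_submodule R M H' \<and> H \<subseteq> H' \<longrightarrow> H' = H)"

text \<open>The submodule \<open>I K\<close>, i.e. the finite sums of elements \<open>a \<odot> x\<close>; modelled on
  \<^const>\<open>ideal_prod\<close>. The empty sum is covered because an ideal contains zero.\<close>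

inductive_set ideal_smult ::
    "('a, 'r) ring_scheme \<Rightarrow> ('a, 'b, 'm) module_scheme \<Rightarrow> 'a set \<Rightarrow> 'b set \<Rightarrow> 'b set"
  for R and M and I and K where
    smult: "\<lbrakk>a \<in> I; x \<in> K\<rbrakk> \<Longrightarrow> a \<odot>\<^bsub>M\<^esub> x \<in> ideal_smult R M I K"
  | add: "\<lbrakk>s \<in> ideal_smult R M I K; t \<in> ideal_smult R M I K\<rbrakk> \<Longrightarrow>
            s \<oplus>\<^bsub>M\<^esub> t \<in> ideal_smult R M I K"

definition second_submodule ::
    "('a, 'r) ring_scheme \<Rightarrow> ('a, 'b, 'm) module_scheme \<Rightarrow> 'b set \<Rightarrow> bool" where
  "second_submodule R M K \<longleftrightarrow>
     submodule K R M \<and> K \<noteq> {\<zero>\<^bsub>M\<^esub>} \<and>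
     (\<forall>I. ideal I R \<longrightarrow> ideal_smult R M I K = K \<or> ideal_smult R M I K = {\<zero>\<^bsub>M\<^esub>})"

text \<open>\<open>M\<close> is the sum, respectively the internal direct sum, of the family \<open>H 0, \<dots>, H (n - 1)\<close>.
  Directness is uniqueness of the representation of elements.\<close>

definition is_sum ::
    "('a, 'b, 'm) module_scheme \<Rightarrow> nat \<Rightarrow> (nat \<Rightarrow> 'b set) \<Rightarrow> bool" where
  "is_sum M n H \<longleftrightarrow>
     carrier M = {\<Oplus>\<^bsub>M\<^esub>i\<in>{..<n}. x i | x. x \<in> (\<Pi> i\<in>{..<n}. H i)}"

definition is_direct_sum ::
    "('a, 'b, 'm) module_scheme \<Rightarrow> nat \<Rightarrow> (nat \<Rightarrow> 'b set) \<Rightarrow> bool" where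
  "is_direct_sum M n H \<longleftrightarrow>
     is_sum M n H \<and>
     (\<forall>x \<in> (\<Pi> i\<in>{..<n}. H i). \<forall>y \<in> (\<Pi> i\<in>{..<n}. H i).
        (\<Oplus>\<^bsub>M\<^esub>i\<in>{..<n}. x i) = (\<Oplus>\<^bsub>M\<^esub>i\<in>{..<n}. y i) \<longrightarrow> (\<forall>i<n. x i = y i))"

definition hollow_representable ::
    "('a, 'r) ring_scheme \<Rightarrow> ('a, 'b, 'm) module_scheme \<Rightarrow> bool" where
  "hollow_representable R M \<longleftrightarrow>
     (\<exists>n H. (\<forall>i<n. hollow_submodule R M (H i)) \<and> is_sum M n H)"

definition directly_hollow_representable ::
    "('a, 'r) ring_scheme \<Rightarrow> ('a, 'b, 'm) module_scheme \<Rightarrow> bool" where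
  "directly_hollow_representable R M \<longleftrightarrow>
     (\<exists>n H. (\<forall>i<n. hollow_submodule R M (H i)) \<and> is_direct_sum M n H)"

definition second_representable ::
    "('a, 'r) ring_scheme \<Rightarrow> ('a, 'b, 'm) module_scheme \<Rightarrow> bool" where
  "second_representable R M \<longleftrightarrow>
     (\<exists>n K. (\<forall>i<n. second_submodule R M (K i)) \<and> is_sum M n K)"

definition directly_second_representable ::
    "('a, 'r) ring_scheme \<Rightarrow> ('a, 'b, 'm) module_scheme \<Rightarrow> bool" where
  "directly_second_representable R M \<longleftrightarrow>
     (\<exists>n K. (\<forall>i<n. second_submodule R M (K i)) \<and> is_direct_sum M n K)"

end

theory Submission
  imports Defs
begin

text \<open>
  Write \<open>M = H\<^sub>0 + \<dots> + H\<^sub>n\<^sub>-\<^sub>1\<close> with hollow \<open>H\<^sub>i\<close> and discard summands until the sum is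
  irredundant. The point is that every summand of an irredundant sum is then already maximal
  among all hollow submodules, so that it is second by hypothesis and nothing has to be
  enlarged. Indeed, let \<open>H\<close> be a summand, \<open>L\<close> the sum of the other ones, and let \<open>H'\<close> be a
  hollow submodule containing \<open>H\<close>. The modular law gives \<open>H' = H + (H' \<inter> L)\<close>, and a hollow
  module is not a sum of two proper submodules: either \<open>H' = H\<close>, or \<open>H' \<subseteq> L\<close>, in which case
  \<open>H \<subseteq> L\<close> contradicts irredundance (lemma \<open>irredundant_hollow_summand_maximal\<close>).

  A subfamily of a family with unique representations again has unique representations, since
  the missing components can be filled up by zeros. Hence the same reduction to an irredundant
  subfamily (lemma \<open>irredundant_hollow_subfamily\<close>) serves both for sums and for direct sums.
\<close>

section \<open>Sums of submodules\<close>

text \<open>Discarding summands leads to index sets other than initial segments of the naturals,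
  so the sum of a family is needed over an arbitrary index set.\<close>

definition indexed_sum ::
    "('a, 'b, 'm) module_scheme \<Rightarrow> 'i set \<Rightarrow> ('i \<Rightarrow> 'b set) \<Rightarrow> 'b set" where
  "indexed_sum M I H = {\<Oplus>\<^bsub>M\<^esub>i\<in>I. x i | x. x \<in> (\<Pi> i\<in>I. H i)}"

lemma is_sum_iff_indexed_sum: "is_sum M n H \<longleftrightarrow> indexed_sum M {..<n} H = carrier M"
  by (auto simp: is_sum_def indexed_sum_def)

context module
begin

lemma submodule_zero: "submodule N R M \<Longrightarrow> \<zero>\<^bsub>M\<^esub> \<in> N"
  using subgroup.one_closed[OF submodule.axioms(1)] by fastforce

lemma submodule_Int:
  assumes "submodule A R M" "submodule B R M"
  shows "submodule (A \<inter> B) R M"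
  using assms submoduleE(1)[OF assms(1)]
  by (intro submoduleI) (auto simp: submodule_zero submoduleE(3-5))

lemma submodule_restrict:
  assumes "submodule N R M" "submodule H R M" "N \<subseteq> H"
  shows "submodule N R (M\<lparr>carrier := H\<rparr>)"
proof -
  have "subgroup N ((add_monoid M)\<lparr>carrier := H\<rparr>)"
    using assms by (intro add.subgroup_incl) (auto dest: submodule.axioms(1))
  then show ?thesis
    using submodule.axioms(2)[OF assms(1)]
    by (auto simp: submodule_def submodule_axioms_def)
qed

lemma set_add_upper1:
  assumes "submodule A R M" "submodule B R M"
  shows "A \<subseteq> A <+>\<^bsub>M\<^esub> B"
proof
  fix a assume "a \<in> A"
  then have "a = a \<oplus>\<^bsub>M\<^esub> \<zero>\<^bsub>M\<^esub>" using submoduleE(1)[OF assms(1)] by auto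
  then show "a \<in> A <+>\<^bsub>M\<^esub> B"
    using \<open>a \<in> A\<close> submodule_zero[OF assms(2)] unfolding set_add_def' by blast
qed

lemma set_add_upper2:
  assumes "submodule A R M" "submodule B R M"
  shows "B \<subseteq> A <+>\<^bsub>M\<^esub> B"
proof
  fix b assume "b \<in> B"
  then have "b = \<zero>\<^bsub>M\<^esub> \<oplus>\<^bsub>M\<^esub> b" using submoduleE(1)[OF assms(2)] by auto
  then show "b \<in> A <+>\<^bsub>M\<^esub> B"
    using \<open>b \<in> B\<close> submodule_zero[OF assms(1)] unfolding set_add_def' by blast
qed

lemma set_add_absorb:
  assumes "submodule A R M" "submodule B R M" "A \<subseteq> B"
  shows "A <+>\<^bsub>M\<^esub> B = B"
proof
  show "A <+>\<^bsub>M\<^esub> B \<subseteq> B"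
    using assms(3) submoduleE(5)[OF assms(2)] unfolding set_add_def' by auto
  show "B \<subseteq> A <+>\<^bsub>M\<^esub> B" using set_add_upper2[OF assms(1,2)] .
qed

lemma submodule_modular_law:
  assumes H: "submodule H R M" and L: "submodule L R M" and K: "submodule K R M"
    and "H \<subseteq> K" "K \<subseteq> H <+>\<^bsub>M\<^esub> L"
  shows "H <+>\<^bsub>M\<^esub> (K \<inter> L) = K"
proof
  show "H <+>\<^bsub>M\<^esub> (K \<inter> L) \<subseteq> K"
    using \<open>H \<subseteq> K\<close> submoduleE(5)[OF K] unfolding set_add_def' by auto
next
  show "K \<subseteq> H <+>\<^bsub>M\<^esub> (K \<inter> L)"
  proof
    fix k assume k: "k \<in> K"
    then obtain h l where hl: "h \<in> H" "l \<in> L" "k = h \<oplus>\<^bsub>M\<^esub> l"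
      using assms(5) unfolding set_add_def' by blast
    have c: "h \<in> carrier M" "l \<in> carrier M" using hl submoduleE(1) H L by auto
    then have "l = \<ominus>\<^bsub>M\<^esub> h \<oplus>\<^bsub>M\<^esub> k" by (simp add: hl(3) M.r_neg1)
    moreover have "\<ominus>\<^bsub>M\<^esub> h \<in> K" using hl \<open>H \<subseteq> K\<close> submoduleE(3)[OF K] by auto
    ultimately have "l \<in> K" using k submoduleE(5)[OF K] by simp
    then show "k \<in> H <+>\<^bsub>M\<^esub> (K \<inter> L)" using hl unfolding set_add_def' by blast
  qed
qed

lemma indexed_sum_submodule:
  assumes "\<And>i. i \<in> I \<Longrightarrow> submodule (H i) R M" "finite I"
  shows "submodule (indexed_sum M I H) R M"
proof -
  have sub: "x \<in> I \<rightarrow> carrier M" if "x \<in> Pi I H" for x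
    using that submoduleE(1)[OF assms(1)] by (auto simp: Pi_iff)
  have scale: "a \<odot>\<^bsub>M\<^esub> y \<in> indexed_sum M I H"
    if a: "a \<in> carrier R" and y: "y \<in> indexed_sum M I H" for a y
  proof -
    from y obtain x where x: "x \<in> Pi I H" "y = (\<Oplus>\<^bsub>M\<^esub>i\<in>I. x i)"
      by (auto simp: indexed_sum_def)
    have "a \<odot>\<^bsub>M\<^esub> y = (\<Oplus>\<^bsub>M\<^esub>i\<in>I. a \<odot>\<^bsub>M\<^esub> x i)"
      using finsum_smult_ldistr[OF assms(2) a sub[OF x(1)]] x(2) by simp
    moreover have "(\<lambda>i. a \<odot>\<^bsub>M\<^esub> x i) \<in> Pi I H"
      using x(1) submoduleE(4)[OF assms(1) a] by (auto simp: Pi_iff)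
    ultimately show ?thesis unfolding indexed_sum_def by blast
  qed
  show ?thesis
  proof (rule submoduleI)
    show subset: "indexed_sum M I H \<subseteq> carrier M"
      using sub by (auto simp: indexed_sum_def)
    have "\<zero>\<^bsub>M\<^esub> = (\<Oplus>\<^bsub>M\<^esub>i\<in>I. \<zero>\<^bsub>M\<^esub>)" by simp
    moreover have "(\<lambda>i. \<zero>\<^bsub>M\<^esub>) \<in> Pi I H" using assms(1) by (auto simp: submodule_zero)
    ultimately show "\<zero>\<^bsub>M\<^esub> \<in> indexed_sum M I H" unfolding indexed_sum_def by blast
    fix y assume y: "y \<in> indexed_sum M I H"
    have "\<ominus>\<^bsub>M\<^esub> y = (\<ominus>\<^bsub>R\<^esub> \<one>\<^bsub>R\<^esub>) \<odot>\<^bsub>M\<^esub> y" using y subset by (auto simp: smult_l_minus)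
    then show "\<ominus>\<^bsub>M\<^esub> y \<in> indexed_sum M I H" using scale y by simp
  next
    fix y z assume "y \<in> indexed_sum M I H" "z \<in> indexed_sum M I H"
    then obtain u v where uv: "u \<in> Pi I H" "v \<in> Pi I H"
      "y = (\<Oplus>\<^bsub>M\<^esub>i\<in>I. u i)" "z = (\<Oplus>\<^bsub>M\<^esub>i\<in>I. v i)"
      by (auto simp: indexed_sum_def)
    have "y \<oplus>\<^bsub>M\<^esub> z = (\<Oplus>\<^bsub>M\<^esub>i\<in>I. u i \<oplus>\<^bsub>M\<^esub> v i)"
      using M.finsum_addf[OF sub sub] uv by simp
    moreover have "(\<lambda>i. u i \<oplus>\<^bsub>M\<^esub> v i) \<in> Pi I H"
      using uv submoduleE(5)[OF assms(1)] by (auto simp: Pi_iff)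
    ultimately show "y \<oplus>\<^bsub>M\<^esub> z \<in> indexed_sum M I H" unfolding indexed_sum_def by blast
  qed (rule scale)
qed

lemma indexed_sum_insert:
  assumes "\<And>j. j \<in> insert i I \<Longrightarrow> submodule (H j) R M" "finite I" "i \<notin> I"
  shows "indexed_sum M (insert i I) H = H i <+>\<^bsub>M\<^esub> indexed_sum M I H"
proof -
  have sub: "x \<in> I \<rightarrow> carrier M" if "x \<in> Pi I H" for x
    using that submoduleE(1)[OF assms(1)] by (auto simp: Pi_iff)
  have sub_i: "H i \<subseteq> carrier M" using submoduleE(1)[OF assms(1)] by auto
  show ?thesis
  proof
    show "indexed_sum M (insert i I) H \<subseteq> H i <+>\<^bsub>M\<^esub> indexed_sum M I H"
    proof
      fix y assume "y \<in> indexed_sum M (insert i I) H"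
      then obtain x where x: "x \<in> Pi (insert i I) H" "y = (\<Oplus>\<^bsub>M\<^esub>j\<in>insert i I. x j)"
        by (auto simp: indexed_sum_def)
      then have "x i \<in> H i" "x \<in> Pi I H" by auto
      moreover from this have "y = x i \<oplus>\<^bsub>M\<^esub> (\<Oplus>\<^bsub>M\<^esub>j\<in>I. x j)"
        using x(2) M.finsum_insert[OF assms(2,3) sub] sub_i by auto
      ultimately show "y \<in> H i <+>\<^bsub>M\<^esub> indexed_sum M I H"
        unfolding set_add_def' indexed_sum_def by blast
    qed
    show "H i <+>\<^bsub>M\<^esub> indexed_sum M I H \<subseteq> indexed_sum M (insert i I) H"
    proof
      fix y assume "y \<in> H i <+>\<^bsub>M\<^esub> indexed_sum M I H"
      then obtain h x where hx: "h \<in> H i" "x \<in> Pi I H" "y = h \<oplus>\<^bsub>M\<^esub> (\<Oplus>\<^bsub>M\<^esub>j\<in>I. x j)"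
        unfolding set_add_def' indexed_sum_def by blast
      define z where "z = x(i := h)"
      have z: "z \<in> Pi (insert i I) H" "z i = h" using hx by (auto simp: z_def)
      have zI: "z \<in> Pi I H" using z(1) by auto
      have "(\<Oplus>\<^bsub>M\<^esub>j\<in>I. z j) = (\<Oplus>\<^bsub>M\<^esub>j\<in>I. x j)"
        using sub[OF hx(2)] assms(3) by (intro M.finsum_cong') (auto simp: z_def)
      then have "y = (\<Oplus>\<^bsub>M\<^esub>j\<in>insert i I. z j)"
        using hx(1,3) z(2) sub_i M.finsum_insert[OF assms(2,3) sub[OF zI]] by auto
      then show "y \<in> indexed_sum M (insert i I) H" using z(1) unfolding indexed_sum_def by blast
    qed
  qed
qed

lemma indexed_sum_reindex:
  assumes "inj_on f A" "\<And>j. j \<in> f ` A \<Longrightarrow> H j \<subseteq> carrier M"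
  shows "indexed_sum M A (H \<circ> f) = indexed_sum M (f ` A) H"
proof
  show "indexed_sum M (f ` A) H \<subseteq> indexed_sum M A (H \<circ> f)"
  proof
    fix y assume "y \<in> indexed_sum M (f ` A) H"
    then obtain x where x: "x \<in> Pi (f ` A) H" "y = (\<Oplus>\<^bsub>M\<^esub>j\<in>f ` A. x j)"
      by (auto simp: indexed_sum_def)
    have "x \<in> f ` A \<rightarrow> carrier M" using x(1) assms(2) by (auto simp: Pi_iff)
    then have "y = (\<Oplus>\<^bsub>M\<^esub>i\<in>A. (x \<circ> f) i)"
      using x(2) M.finsum_reindex[OF _ assms(1)] by simp
    moreover have "x \<circ> f \<in> Pi A (H \<circ> f)" using x(1) by auto
    ultimately show "y \<in> indexed_sum M A (H \<circ> f)" unfolding indexed_sum_def by blast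
  qed
  show "indexed_sum M A (H \<circ> f) \<subseteq> indexed_sum M (f ` A) H"
  proof
    fix y assume "y \<in> indexed_sum M A (H \<circ> f)"
    then obtain x where x: "x \<in> Pi A (H \<circ> f)" "y = (\<Oplus>\<^bsub>M\<^esub>i\<in>A. x i)"
      unfolding indexed_sum_def by blast
    define z where "z = x \<circ> inv_into A f"
    have zf: "z (f i) = x i" if "i \<in> A" for i using that assms(1) by (simp add: z_def)
    have z: "z \<in> Pi (f ` A) H" using x(1) zf by (auto simp: Pi_iff)
    then have c: "z \<in> f ` A \<rightarrow> carrier M" using assms(2) by (auto simp: Pi_iff)
    have "y = (\<Oplus>\<^bsub>M\<^esub>i\<in>A. z (f i))"
      unfolding x(2) using c zf by (intro M.finsum_cong') (auto simp: Pi_iff)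
    then have "y = (\<Oplus>\<^bsub>M\<^esub>j\<in>f ` A. z j)"
      using M.finsum_reindex[OF c assms(1)] by simp
    then show "y \<in> indexed_sum M (f ` A) H" using z unfolding indexed_sum_def by blast
  qed
qed

text \<open>Two representations over the subfamily are extended by zeros to representations over the
  whole family, where uniqueness applies.\<close>

lemma is_direct_sum_subfamily:
  assumes direct: "is_direct_sum M n H" and sub: "\<And>i. i < n \<Longrightarrow> submodule (H i) R M"
    and inj: "inj_on f {..<m}" and f: "f ` {..<m} \<subseteq> {..<n}"
    and total: "is_sum M m (H \<circ> f)"
  shows "is_direct_sum M m (H \<circ> f)"
proof -
  define ext where
    "ext x j = (if j \<in> f ` {..<m} then x (inv_into {..<m} f j) else \<zero>\<^bsub>M\<^esub>)" for x j
  have ext_f: "ext x (f i) = x i" if "i < m" for x i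
    using that inj by (simp add: ext_def)
  have ext_mem: "ext x \<in> (\<Pi> j\<in>{..<n}. H j)" if "x \<in> (\<Pi> i\<in>{..<m}. (H \<circ> f) i)" for x
  proof
    fix j assume j: "j \<in> {..<n}"
    show "ext x j \<in> H j"
    proof (cases "j \<in> f ` {..<m}")
      case True
      then obtain i where "i < m" "j = f i" by auto
      then show ?thesis using that ext_f by auto
    next
      case False
      then show ?thesis using j sub by (simp add: ext_def submodule_zero)
    qed
  qed
  have ext_sum: "(\<Oplus>\<^bsub>M\<^esub>j\<in>{..<n}. ext x j) = (\<Oplus>\<^bsub>M\<^esub>i\<in>{..<m}. x i)"
    if x: "x \<in> (\<Pi> i\<in>{..<m}. (H \<circ> f) i)" for x
  proof -
    have c: "ext x \<in> {..<n} \<rightarrow> carrier M"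
      using ext_mem[OF x] submoduleE(1)[OF sub] by (auto simp: Pi_iff)
    then have cf: "ext x \<in> f ` {..<m} \<rightarrow> carrier M" using f by auto
    have "(\<Oplus>\<^bsub>M\<^esub>j\<in>{..<n}. ext x j) = (\<Oplus>\<^bsub>M\<^esub>j\<in>f ` {..<m}. ext x j)"
      using f c by (intro M.add.finprod_mono_neutral_cong_right) (auto simp: ext_def)
    also have "\<dots> = (\<Oplus>\<^bsub>M\<^esub>i\<in>{..<m}. ext x (f i))"
      using M.finsum_reindex[OF cf inj] .
    also have "\<dots> = (\<Oplus>\<^bsub>M\<^esub>i\<in>{..<m}. x i)"
    proof (rule M.finsum_cong')
      show "x \<in> {..<m} \<rightarrow> carrier M"
      proof
        fix i assume "i \<in> {..<m}"
        then show "x i \<in> carrier M" using cf ext_f[of i x] by (metis PiE imageI lessThan_iff)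
      qed
    qed (simp_all add: ext_f)
    finally show ?thesis .
  qed
  have "x i = y i"
    if "x \<in> (\<Pi> i\<in>{..<m}. (H \<circ> f) i)" "y \<in> (\<Pi> i\<in>{..<m}. (H \<circ> f) i)"
      "(\<Oplus>\<^bsub>M\<^esub>i\<in>{..<m}. x i) = (\<Oplus>\<^bsub>M\<^esub>i\<in>{..<m}. y i)" "i < m" for x y i
  proof -
    have "(\<Oplus>\<^bsub>M\<^esub>j\<in>{..<n}. ext x j) = (\<Oplus>\<^bsub>M\<^esub>j\<in>{..<n}. ext y j)"
      using that ext_sum by simp
    then have "\<forall>j<n. ext x j = ext y j"
      using direct ext_mem that(1,2) unfolding is_direct_sum_def by blast
    moreover have "f i < n" using f \<open>i < m\<close> by auto
    ultimately show ?thesis using ext_f[OF \<open>i < m\<close>] by metis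
  qed
  then show ?thesis using total unfolding is_direct_sum_def by blast
qed

section \<open>Hollow summands of irredundant sums\<close>

lemma hollow_submodule_sum_cases:
  assumes "hollow_submodule R M H" "submodule A R M" "submodule B R M" "A <+>\<^bsub>M\<^esub> B = H"
  shows "A = H \<or> B = H"
proof -
  have H: "submodule H R M" and "hollow R (M\<lparr>carrier := H\<rparr>)"
    using assms(1) by (auto simp: hollow_submodule_def)
  moreover have "A \<subseteq> H" "B \<subseteq> H"
    using set_add_upper1 set_add_upper2 assms(2-4) by blast+
  then have "submodule A R (M\<lparr>carrier := H\<rparr>)" "submodule B R (M\<lparr>carrier := H\<rparr>)"
    using submodule_restrict assms(2,3) H by auto
  moreover have "A <+>\<^bsub>M\<lparr>carrier := H\<rparr>\<^esub> B = H"
    using assms(4) by (simp add: set_add_def')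
  ultimately show ?thesis unfolding hollow_def small_submodule_def by auto
qed

text \<open>A hollow \<open>H'\<close> containing \<open>H\<close> is, by the modular law, the sum of \<open>H\<close> and \<open>H' \<inter> L\<close>, hence
  equal to one of them; equality with \<open>H' \<inter> L\<close> would put \<open>H\<close> into \<open>L\<close>.\<close>

lemma irredundant_hollow_summand_maximal:
  assumes H: "hollow_submodule R M H" and L: "submodule L R M"
    and "H <+>\<^bsub>M\<^esub> L = carrier M" "\<not> H \<subseteq> L"
  shows "maximal_hollow_submodule R M H"
  unfolding maximal_hollow_submodule_def
proof (intro conjI allI impI H)
  fix H' assume "hollow_submodule R M H' \<and> H \<subseteq> H'"
  then have H': "hollow_submodule R M H'" and "H \<subseteq> H'" by auto
  have sub: "submodule H R M" "submodule H' R M"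
    using H H' by (auto simp: hollow_submodule_def)
  have "H <+>\<^bsub>M\<^esub> (H' \<inter> L) = H'"
    using sub L \<open>H \<subseteq> H'\<close> assms(3) submoduleE(1)[OF sub(2)]
    by (intro submodule_modular_law) auto
  then have "H = H' \<or> H' \<inter> L = H'"
    using hollow_submodule_sum_cases[OF H'] sub submodule_Int L by blast
  then show "H' = H" using \<open>H \<subseteq> H'\<close> assms(4) by blast
qed

text \<open>The subfamily is one with the fewest indices among those that still sum to \<open>M\<close>: a summand
  lying in the sum of the others, such as the zero submodule, could be omitted from it.\<close>

lemma irredundant_hollow_subfamily:
  assumes hollow: "\<And>i. i < n \<Longrightarrow> hollow_submodule R M (H i)" and total: "is_sum M n H"
  obtains m f where "inj_on f {..<m}" "f ` {..<m} \<subseteq> {..<n}" "is_sum M m (H \<circ> f)"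
    "\<forall>i<m. maximal_hollow_submodule R M (H (f i)) \<and> H (f i) \<noteq> {\<zero>\<^bsub>M\<^esub>}"
proof -
  have sub: "submodule (H i) R M" if "i < n" for i
    using hollow[OF that] by (simp add: hollow_submodule_def)
  define P where "P J \<longleftrightarrow> J \<subseteq> {..<n} \<and> indexed_sum M J H = carrier M" for J
  have "P {..<n}" using total by (simp add: P_def is_sum_iff_indexed_sum)
  then obtain J where "P J" and minimal: "\<And>J'. P J' \<Longrightarrow> card J \<le> card J'"
    using ex_has_least_nat[of P _ card] by blast
  then have J: "J \<subseteq> {..<n}" "indexed_sum M J H = carrier M" by (auto simp: P_def)
  then have fin: "finite J" using finite_subset by blast
  have maximal: "maximal_hollow_submodule R M (H j) \<and> H j \<noteq> {\<zero>\<^bsub>M\<^esub>}" if j: "j \<in> J" for j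
  proof -
    define L where "L = indexed_sum M (J - {j}) H"
    have L: "submodule L R M"
      unfolding L_def using J(1) fin sub by (intro indexed_sum_submodule) auto
    have Hj: "hollow_submodule R M (H j)" "submodule (H j) R M"
      using j J(1) hollow sub by auto
    have sum: "H j <+>\<^bsub>M\<^esub> L = carrier M"
      using indexed_sum_insert[of j "J - {j}" H] J sub j fin
      by (auto simp: L_def insert_absorb subset_iff)
    have "\<not> H j \<subseteq> L"
    proof
      assume "H j \<subseteq> L"
      then have "L = carrier M" using set_add_absorb[OF Hj(2) L] sum by simp
      then have "P (J - {j})" using J(1) by (auto simp: P_def L_def)
      then have "card J \<le> card (J - {j})" by (rule minimal)
      then show False using card_Diff1_less[OF fin j] by simp
    qed
    then show ?thesis
      using irredundant_hollow_summand_maximal[OF Hj(1) L sum] submodule_zero[OF L] by auto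
  qed
  obtain f where f: "bij_betw f {..<card J} J"
    using ex_bij_betw_nat_finite[OF fin] by (auto simp: atLeast0LessThan)
  have inj: "inj_on f {..<card J}" and im: "f ` {..<card J} = J"
    using f by (auto simp: bij_betw_def)
  have "H j \<subseteq> carrier M" if "j \<in> f ` {..<card J}" for j
    using that im J(1) submoduleE(1)[OF sub] by blast
  then have "is_sum M (card J) (H \<circ> f)"
    using indexed_sum_reindex[OF inj, of H] im J(2) by (simp add: is_sum_iff_indexed_sum)
  then show thesis
    using that[OF inj] im J(1) maximal by blast
qed

end

theorem proposition2p18:
  fixes R :: "('a, 'r) ring_scheme" and M :: "('a, 'b, 'm) module_scheme"
  assumes "module R M"
    and "carrier M \<noteq> {\<zero>\<^bsub>M\<^esub>}"
    and "\<And>H. \<lbrakk>maximal_hollow_submodule R M H; H \<noteq> {\<zero>\<^bsub>M\<^esub>}\<rbrakk> \<Longrightarrow> second_submodule R M H"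
  shows "(hollow_representable R M \<longrightarrow> second_representable R M) \<and>
         (directly_hollow_representable R M \<longrightarrow> directly_second_representable R M)"
proof (intro conjI impI)
  interpret module R M by fact
  show "second_representable R M" if "hollow_representable R M"
  proof -
    from that obtain n H
      where "\<And>i. i < n \<Longrightarrow> hollow_submodule R M (H i)" "is_sum M n H"
      unfolding hollow_representable_def by blast
    then obtain m f where "is_sum M m (H \<circ> f)"
      "\<forall>i<m. maximal_hollow_submodule R M (H (f i)) \<and> H (f i) \<noteq> {\<zero>\<^bsub>M\<^esub>}"
      by (rule irredundant_hollow_subfamily) blast
    then show ?thesis
      using assms(3) unfolding second_representable_def by (metis comp_apply)
  qed
  show "directly_second_representable R M" if "directly_hollow_representable R M"
  proof -
    from that obtain n H
      where hollow: "\<And>i. i < n \<Longrightarrow> hollow_submodule R M (H i)" and direct: "is_direct_sum M n H"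
      unfolding directly_hollow_representable_def by blast
    have total: "is_sum M n H" using direct by (simp add: is_direct_sum_def)
    from hollow total obtain m f
      where f: "inj_on f {..<m}" "f ` {..<m} \<subseteq> {..<n}" "is_sum M m (H \<circ> f)"
      "\<forall>i<m. maximal_hollow_submodule R M (H (f i)) \<and> H (f i) \<noteq> {\<zero>\<^bsub>M\<^esub>}"
      by (rule irredundant_hollow_subfamily) blast
    have "is_direct_sum M m (H \<circ> f)"
      using is_direct_sum_subfamily[OF direct _ f(1-3)] hollow
      by (auto simp: hollow_submodule_def)
    then show ?thesis
      using f(4) assms(3) unfolding directly_second_representable_def by (metis comp_apply)
  qed
qed

end
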